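(* Let $m>n$ be positive integers, let $Z=m_1P_1+\cdots+m_sP_s$ be fat points in $\mathbb P^n$ (with $P_1,\dots,P_s$ distinct points and $m_1,\dots,m_s$ positive integers), and let $\phi_{n,m}:\mathbb P^n\to\mathbb P^m$ be the embedding. a) If $m=n+1$ and $0\le t<\operatorname{reg}(R_n/I_Z)$, then $$H_{R_{n+1}/I_{\phi_{n,n+1}(Z)}}(t)=H_{R_n/I_Z}(t)+\sum_{i=0}^{t-1}H_{R_n/(\wp_1^{m_1-t+i}\cap\cdots\cap\wp_s^{m_s-t+i})}(i).$$ b) For every integer $t\ge 0$, $H_{R_m/I_{\phi_{n,m}(Z)}}(t)\ge H_{R_n/I_Z}(t)$. c) If there exists $j$ with $m_j\ge 2$, then for every integer $t\ge 0$, $H_{R_m/I_{\phi_{n,m}(Z)}}(t)>H_{R_n/I_Z}(t)$.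
   Context: $K$ is an algebraically closed field, $\mathbb P^n$ is the $n$-dimensional projective space over $K$, and $R_n=K[X_0,\dots,X_n]$ (similarly $R_m=K[X_0,\dots,X_m]\supset R_n$), with the standard grading. Given distinct points $P_1,\dots,P_s\in\mathbb P^n$ and positive integers $m_1,\dots,m_s$, let $\wp_i\subset R_n$ be the homogeneous prime ideal of $P_i$; the fat points $Z=m_1P_1+\cdots+m_sP_s$ is the zero-scheme defined by $I_Z=\wp_1^{m_1}\cap\cdots\cap\wp_s^{m_s}$. Convention: $\wp_i^r=R_n$ whenever $r\le 0$. For a homogeneous ideal $I\subset R_n$, the Hilbert function is $H_{R_n/I}(t)=\dim_K(R_n/I)_t$ (and likewise for homogeneous ideals of $R_m$). The multiplicity is $e(R_n/I_Z)=\sum_{i=1}^s\binom{m_i+n-1}{n}$ and the regularity index is $\operatorname{reg}(R_n/I_Z)=\min\{t\in\mathbb N\mid H_{R_n/I_Z}(t)=e(R_n/I_Z)\}$. For $m>n$ the embedding $\phi_{n,m}:\mathbb P^n\to\mathbb P^m$ is $(a_0,\dots,a_n)\mapsto(a_0,\dots,a_n,0,\dots,0)$ in homogeneous coordinates. Let $\mathfrak q_i\subset R_m$ be the homogeneous prime ideal of $\phi_{n,m}(P_i)$; then $\phi_{n,m}(Z)=m_1\phi_{n,m}(P_1)+\cdots+m_s\phi_{n,m}(P_s)$ is the fat points in $\mathbb P^m$ defined by $I_{\phi_{n,m}(Z)}=\mathfrak q_1^{m_1}\cap\cdots\cap\mathfrak q_s^{m_s}$.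
   Formalization: Part c) is stated for every integer t ≥ 1 instead of t ≥ 0: at t = 0 both Hilbert functions equal 1, so the strict inequality fails there for every Z. *)

theory Defs
  imports
    "HOL-Algebra.Embedded_Algebras"
    "HOL-Algebra.Ideal_Product"
    "HOL-Algebra.QuotRing"
    "HOL-Computational_Algebra.Polynomial"
    "HOL-Library.Poly_Mapping"
    "HOL-Library.FuncSet"
begin

section \<open>Polynomial rings\<close>

text \<open>
  Monomials are exponent vectors \<open>nat \<Rightarrow>\<^sub>0 nat\<close>, and variables are indexed by all naturals. The ring
  \<open>R\<^sub>n = K[X\<^sub>0, \<dots>, X\<^sub>n]\<close> is the subring of polynomials in which only \<open>X\<^sub>0, \<dots>, X\<^sub>n\<close> occur, so
  that \<open>R\<^sub>n\<close> is literally contained in \<open>R\<^sub>m\<close> for \<open>n \<le> m\<close>.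
\<close>

type_synonym 'a mpol = "(nat \<Rightarrow>\<^sub>0 nat) \<Rightarrow>\<^sub>0 'a"

definition poly_ring :: "nat \<Rightarrow> 'a::field mpol ring" where
  "poly_ring n =
    \<lparr>carrier = {f. \<forall>u \<in> Poly_Mapping.keys f. Poly_Mapping.keys u \<subseteq> {..n}},
     monoid.mult = (*), one = 1, zero = 0, add = (+)\<rparr>"

definition const_pol :: "'a::field \<Rightarrow> 'a mpol" where
  "const_pol c = Poly_Mapping.single 0 c"

definition mon_degree :: "(nat \<Rightarrow>\<^sub>0 nat) \<Rightarrow> nat" where
  "mon_degree u = (\<Sum>i \<in> Poly_Mapping.keys u. Poly_Mapping.lookup u i)"

definition homog_part :: "nat \<Rightarrow> nat \<Rightarrow> 'a::field mpol set" where
  "homog_part n d =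
    {f \<in> carrier (poly_ring n). \<forall>u \<in> Poly_Mapping.keys f. mon_degree u = d}"

definition eval_pol :: "'a::field mpol \<Rightarrow> (nat \<Rightarrow> 'a) \<Rightarrow> 'a" where
  "eval_pol f a = (\<Sum>u \<in> Poly_Mapping.keys f.
     Poly_Mapping.lookup f u * (\<Prod>i \<in> Poly_Mapping.keys u. a i ^ Poly_Mapping.lookup u i))"


section \<open>Projective space\<close>

definition nonzero_vecs :: "nat \<Rightarrow> (nat \<Rightarrow> 'a::field) set" where
  "nonzero_vecs n = {a \<in> {..n} \<rightarrow>\<^sub>E UNIV. \<exists>i \<le> n. a i \<noteq> 0}"

definition proportional :: "nat \<Rightarrow> ((nat \<Rightarrow> 'a::field) \<times> (nat \<Rightarrow> 'a)) set" where
  "proportional n = {(a, b). a \<in> nonzero_vecs n \<and> b \<in> nonzero_vecs n \<and>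
     (\<exists>c. c \<noteq> 0 \<and> (\<forall>i \<le> n. b i = c * a i))}"

definition proj_space :: "nat \<Rightarrow> (nat \<Rightarrow> 'a::field) set set" where
  "proj_space n = nonzero_vecs n // proportional n"

text \<open>
  A point is the set of all its vectors of homogeneous coordinates, so the embedding of
  projective spaces is the image under the embedding of coordinate vectors.
\<close>

definition proj_embed :: "nat \<Rightarrow> nat \<Rightarrow> (nat \<Rightarrow> 'a::field) set \<Rightarrow> (nat \<Rightarrow> 'a) set" where
  "proj_embed n m p = (\<lambda>a. \<lambda>i \<in> {..m}. if i \<le> n then a i else 0) ` p"


section \<open>Fat points\<close>

definition point_ideal :: "nat \<Rightarrow> (nat \<Rightarrow> 'a::field) set \<Rightarrow> 'a mpol set" where
  "point_ideal n p =
    Idl\<^bsub>poly_ring n\<^esub> {f. (\<exists>d. f \<in> homog_part n d) \<and> (\<forall>a \<in> p. eval_pol f a = 0)}"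

text \<open>
  Exponents are integers. For \<open>r \<le> 0\<close> we have \<open>nat r = 0\<close>, and the zeroth power in the monoid
  of ideals is the whole ring, which is the convention wanted for nonpositive exponents.
\<close>

definition point_ideal_pow :: "nat \<Rightarrow> (nat \<Rightarrow> 'a::field) set \<Rightarrow> int \<Rightarrow> 'a mpol set" where
  "point_ideal_pow n p r = point_ideal n p [^]\<^bsub>ideals_set (poly_ring n)\<^esub> nat r"

text \<open>
  The points are \<open>P 1, \<dots>, P s\<close>. Intersecting with the carrier only matters for \<open>s = 0\<close>.
\<close>

definition fat_ideal ::
  "nat \<Rightarrow> nat \<Rightarrow> (nat \<Rightarrow> (nat \<Rightarrow> 'a::field) set) \<Rightarrow> (nat \<Rightarrow> int) \<Rightarrow> 'a mpol set" where
  "fat_ideal n s P r =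
    carrier (poly_ring n) \<inter> (\<Inter>j \<in> {1..s}. point_ideal_pow n (P j) (r j))"


section \<open>Hilbert function, multiplicity, regularity index\<close>

text \<open>
  Inside the quotient ring \<open>R\<^sub>n/I\<close>, the scalar field is the image of the constants and the
  degree \<open>t\<close> component is the image of the forms of degree \<open>t\<close>. If \<open>I = R\<^sub>n\<close>, the quotient
  is the zero ring and the dimension is \<open>0\<close>.
\<close>

definition hilbert_fun :: "nat \<Rightarrow> 'a::field mpol set \<Rightarrow> nat \<Rightarrow> nat" where
  "hilbert_fun n I t =
    ring.dim (poly_ring n Quot I)
      (range (\<lambda>c. I +>\<^bsub>poly_ring n\<^esub> const_pol c))
      ((\<lambda>f. I +>\<^bsub>poly_ring n\<^esub> f) ` homog_part n t)"

definition multiplicity_fat :: "nat \<Rightarrow> nat \<Rightarrow> (nat \<Rightarrow> nat) \<Rightarrow> nat" where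
  "multiplicity_fat n s \<mu> = (\<Sum>j = 1..s. (\<mu> j + n - 1) choose n)"

definition reg_index ::
  "nat \<Rightarrow> nat \<Rightarrow> (nat \<Rightarrow> (nat \<Rightarrow> 'a::field) set) \<Rightarrow> (nat \<Rightarrow> nat) \<Rightarrow> nat" where
  "reg_index n s P \<mu> =
    (LEAST t. hilbert_fun n (fat_ideal n s P (\<lambda>j. int (\<mu> j))) t = multiplicity_fat n s \<mu>)"

end

theory Submission
  imports Defs
begin

text \<open>
  The ideal of an embedded point is \<open>\<qq> = (\<wp>, X\<^sub>n\<^sub>+\<^sub>1)\<close>, so a polynomial lies in \<open>\<qq>\<^sup>r\<close> iff for
  every \<open>k\<close> its coefficient at \<open>X\<^sub>n\<^sub>+\<^sub>1\<^sup>k\<close> lies in \<open>\<wp>\<^sup>r\<^sup>-\<^sup>k\<close>. Intersecting over the points, the degree \<open>t\<close>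
  part of \<open>R\<^sub>n\<^sub>+\<^sub>1\<close> modulo the fat ideal splits into the degree \<open>t - k\<close> parts of \<open>R\<^sub>n\<close> modulo the fat
  ideals with all multiplicities lowered by \<open>k\<close>. This gives a) in every degree, and b) by induction
  on the dimension of the ambient space. For c), the summand with \<open>k = 1\<close> is positive, since some
  lowered multiplicity is still positive and no power of a coordinate that is nonzero at the point
  lies in the ideal of that point.
\<close>

subsection \<open>The polynomial rings\<close>

lemma carrier_poly_ring:
  "f \<in> carrier (poly_ring n) \<longleftrightarrow> (\<forall>u \<in> Poly_Mapping.keys f. Poly_Mapping.keys u \<subseteq> {..n})"
  by (simp add: poly_ring_def)

lemma poly_ring_simps [simp]:
  "x \<otimes>\<^bsub>poly_ring n\<^esub> y = x * y" "x \<oplus>\<^bsub>poly_ring n\<^esub> y = x + y"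
  "\<zero>\<^bsub>poly_ring n\<^esub> = 0" "\<one>\<^bsub>poly_ring n\<^esub> = 1"
  by (simp_all add: poly_ring_def)

lemma zero_carrier [simp, intro]: "0 \<in> carrier (poly_ring n)"
  and one_carrier [simp, intro]: "1 \<in> carrier (poly_ring n)"
  by (auto simp: carrier_poly_ring)

lemma add_carrier [intro]:
  "f \<in> carrier (poly_ring n) \<Longrightarrow> g \<in> carrier (poly_ring n) \<Longrightarrow> f + g \<in> carrier (poly_ring n)"
  using Poly_Mapping.keys_add[of f g] by (fastforce simp: carrier_poly_ring)

lemma uminus_carrier [intro]:
  "f \<in> carrier (poly_ring n) \<Longrightarrow> - f \<in> carrier (poly_ring n)"
  by (simp add: carrier_poly_ring in_keys_iff)

lemma mult_carrier [intro]:
  assumes "f \<in> carrier (poly_ring n)" "g \<in> carrier (poly_ring n)"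
  shows "f * g \<in> carrier (poly_ring n)"
  unfolding carrier_poly_ring
proof
  fix w assume "w \<in> Poly_Mapping.keys (f * g)"
  then obtain u v where "w = u + v" "u \<in> Poly_Mapping.keys f" "v \<in> Poly_Mapping.keys g"
    using Poly_Mapping.keys_mult[of f g] by blast
  then show "Poly_Mapping.keys w \<subseteq> {..n}"
    using assms Poly_Mapping.keys_add[of u v] by (fastforce simp: carrier_poly_ring)
qed

lemma const_pol_carrier [simp, intro]: "const_pol c \<in> carrier (poly_ring n)"
  by (auto simp: carrier_poly_ring const_pol_def)

lemma sum_carrier [intro]:
  "(\<And>i. i \<in> A \<Longrightarrow> f i \<in> carrier (poly_ring n)) \<Longrightarrow> sum f A \<in> carrier (poly_ring n)"
  by (induction A rule: infinite_finite_induct) auto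

lemma poly_ring_mono: "n \<le> m \<Longrightarrow> carrier (poly_ring n) \<subseteq> carrier (poly_ring m)"
  by (fastforce simp: carrier_poly_ring)

lemma cring_poly_ring: "cring (poly_ring n :: 'a::field mpol ring)"
proof (rule cringI)
  show "abelian_group (poly_ring n :: 'a mpol ring)"
    by (rule abelian_groupI) (auto simp: algebra_simps intro: bexI[of _ "- _"])
  show "comm_monoid (poly_ring n :: 'a mpol ring)"
    by (rule comm_monoidI) (auto simp: algebra_simps)
qed (auto simp: algebra_simps)

interpretation poly_ring: cring "poly_ring n :: 'a::field mpol ring" for n
  by (rule cring_poly_ring)

lemma a_inv_poly_ring:
  assumes "f \<in> carrier (poly_ring n)"
  shows "\<ominus>\<^bsub>poly_ring n\<^esub> f = - f"
  by (rule poly_ring.minus_equality) (use assms in auto)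

lemma a_minus_poly_ring:
  assumes "g \<in> carrier (poly_ring n)"
  shows "f \<ominus>\<^bsub>poly_ring n\<^esub> g = f - g"
  using assms by (simp add: a_minus_def a_inv_poly_ring)

section \<open>Ideals of the polynomial ring in terms of the type class operations\<close>

lemma ideal_poly_ringD:
  assumes "ideal I (poly_ring n)"
  shows "I \<subseteq> carrier (poly_ring n)" "0 \<in> I"
    and "\<And>f g. f \<in> I \<Longrightarrow> g \<in> I \<Longrightarrow> f + g \<in> I"
    and "\<And>h f. h \<in> carrier (poly_ring n) \<Longrightarrow> f \<in> I \<Longrightarrow> h * f \<in> I"
proof -
  interpret ideal I "poly_ring n" by fact
  show "I \<subseteq> carrier (poly_ring n)" by (rule a_subset)
  show "0 \<in> I" using zero_closed by simp
  show "f + g \<in> I" if "f \<in> I" "g \<in> I" for f g using a_closed[OF that] by simp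
  show "h * f \<in> I" if "h \<in> carrier (poly_ring n)" "f \<in> I" for h f
    using I_l_closed[OF that(2,1)] by simp
qed

lemma ideal_sum_closed:
  assumes "ideal I (poly_ring n)" "\<And>i. i \<in> A \<Longrightarrow> f i \<in> I"
  shows "sum f A \<in> I"
  using assms(2) ideal_poly_ringD(2,3)[OF assms(1)]
  by (induction A rule: infinite_finite_induct) auto

text \<open>Negation is multiplication by \<open>- 1\<close> and the ring is commutative, so closure
  under sums and left multiples suffices.\<close>

lemma ideal_poly_ringI:
  fixes I :: "'a::field mpol set"
  assumes "I \<subseteq> carrier (poly_ring n)" "0 \<in> I"
    and "\<And>f g. f \<in> I \<Longrightarrow> g \<in> I \<Longrightarrow> f + g \<in> I"
    and "\<And>h f. h \<in> carrier (poly_ring n) \<Longrightarrow> f \<in> I \<Longrightarrow> h * f \<in> I"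
  shows "ideal I (poly_ring n)"
proof (rule idealI)
  show "ring (poly_ring n)" by (rule poly_ring.ring_axioms)
  have inv: "- f \<in> I" if "f \<in> I" for f
    using assms(4)[of "- 1" f] that by (auto simp: uminus_carrier)
  show "subgroup I (add_monoid (poly_ring n))"
  proof (rule poly_ring.add.subgroupI)
    show "I \<noteq> {}" using assms(2) by blast
    show "\<ominus>\<^bsub>poly_ring n\<^esub> f \<in> I" if "f \<in> I" for f
      using inv[OF that] a_inv_poly_ring[of f n] that assms(1) by auto
  qed (use assms in auto)
  show "f \<otimes>\<^bsub>poly_ring n\<^esub> h \<in> I" "h \<otimes>\<^bsub>poly_ring n\<^esub> f \<in> I"
    if "f \<in> I" "h \<in> carrier (poly_ring n)" for f h
    using assms(4)[OF that(2,1)] by (simp_all add: mult.commute)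
qed

section \<open>Expansion into monomials and evaluation at a vector\<close>

lemma poly_mapping_sum_single:
  "f = (\<Sum>u \<in> Poly_Mapping.keys f. Poly_Mapping.single u (Poly_Mapping.lookup f u))"
  by (rule poly_mapping_eqI)
    (auto simp: lookup_sum lookup_single when_def in_keys_iff sum.If_cases if_distrib
      Int_def cong: if_cong)

definition eval_mon :: "(nat \<Rightarrow> 'a::field) \<Rightarrow> (nat \<Rightarrow>\<^sub>0 nat) \<Rightarrow> 'a" where
  "eval_mon a u = (\<Prod>i \<in> Poly_Mapping.keys u. a i ^ Poly_Mapping.lookup u i)"

lemma eval_mon_add: "eval_mon a (u + v) = eval_mon a u * eval_mon a v"
proof -
  \<comment> \<open>The supports of \<open>u\<close>, \<open>v\<close> and \<open>u + v\<close> may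
    differ, so all three products are taken over one common finite set; the extra factors have
    exponent 0.\<close>
  have *: "eval_mon a w = (\<Prod>i \<in> A. a i ^ Poly_Mapping.lookup w i)"
    if "finite A" "Poly_Mapping.keys w \<subseteq> A" for w and A
    unfolding eval_mon_def using that by (intro prod.mono_neutral_left) (auto simp: in_keys_iff)
  let ?A = "Poly_Mapping.keys u \<union> Poly_Mapping.keys v"
  show ?thesis
    by (subst (1 2 3) *[of ?A])
      (auto simp: lookup_add power_add prod.distrib dest!: Poly_Mapping.keys_add[THEN subsetD])
qed

lemma eval_mon_single [simp]: "eval_mon a (Poly_Mapping.single i k) = a i ^ k"
  by (cases "k = 0") (auto simp: eval_mon_def)

lemma eval_pol_alt:
  "eval_pol f a = (\<Sum>u \<in> Poly_Mapping.keys f. Poly_Mapping.lookup f u * eval_mon a u)"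
  by (simp add: eval_pol_def eval_mon_def)

lemma eval_pol_zero [simp]: "eval_pol 0 a = 0"
  by (simp add: eval_pol_def)

lemma eval_pol_single [simp]: "eval_pol (Poly_Mapping.single u c) a = c * eval_mon a u"
  by (cases "c = 0") (auto simp: eval_pol_alt)

lemma eval_pol_add: "eval_pol (f + g) a = eval_pol f a + eval_pol g a"
  unfolding eval_pol_alt
  by (rule setsum_keys_plus_distrib) (auto simp: algebra_simps)

lemma eval_pol_sum: "eval_pol (sum f A) a = (\<Sum>i \<in> A. eval_pol (f i) a)"
  by (induction A rule: infinite_finite_induct) (auto simp: eval_pol_add)

lemma eval_pol_mult: "eval_pol (f * g) a = eval_pol f a * eval_pol g a"
proof -
  have "f * g = (\<Sum>u \<in> Poly_Mapping.keys f. \<Sum>v \<in> Poly_Mapping.keys g.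
      Poly_Mapping.single (u + v) (Poly_Mapping.lookup f u * Poly_Mapping.lookup g v))"
    by (subst (1) poly_mapping_sum_single[of f], subst (1) poly_mapping_sum_single[of g])
      (simp add: sum_product mult_single)
  then show ?thesis
    by (simp add: eval_pol_sum eval_mon_add eval_pol_alt[of f] eval_pol_alt[of g] sum_product
        mult_ac)
qed


section \<open>Indeterminates, degrees and forms\<close>

definition indet :: "nat \<Rightarrow> 'a::field mpol" where
  "indet i = Poly_Mapping.single (Poly_Mapping.single i 1) 1"

lemma indet_power: "indet i ^ k = Poly_Mapping.single (Poly_Mapping.single i k) 1"
  by (induction k) (auto simp: indet_def mult_single simp flip: single_add)

lemma eval_pol_indet_power [simp]: "eval_pol (indet i ^ k) a = a i ^ k"
  by (simp add: indet_power)

lemma eval_pol_indet [simp]: "eval_pol (indet i) a = a i"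
  by (simp add: indet_def)

lemma indet_power_carrier: "i \<le> n \<Longrightarrow> indet i ^ k \<in> carrier (poly_ring n)"
  by (cases "k = 0") (auto simp: indet_power carrier_poly_ring)

lemma mon_degree_superset:
  assumes "finite A" "Poly_Mapping.keys u \<subseteq> A"
  shows "mon_degree u = (\<Sum>i \<in> A. Poly_Mapping.lookup u i)"
  unfolding mon_degree_def using assms by (intro sum.mono_neutral_left) (auto simp: in_keys_iff)

lemma mon_degree_add: "mon_degree (u + v) = mon_degree u + mon_degree v"
  unfolding mon_degree_def by (rule setsum_keys_plus_distrib) auto

lemma mon_degree_single [simp]: "mon_degree (Poly_Mapping.single i k) = k"
  by (cases "k = 0") (auto simp: mon_degree_def)

lemma homog_part_carrier: "f \<in> homog_part n d \<Longrightarrow> f \<in> carrier (poly_ring n)"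
  by (simp add: homog_part_def)

lemma homog_part_mono: "n \<le> m \<Longrightarrow> homog_part n d \<subseteq> homog_part m d"
  using poly_ring_mono[of n m] by (auto simp: homog_part_def)

lemma zero_homog_part [simp]: "0 \<in> homog_part n d"
  by (simp add: homog_part_def)

lemma add_homog_part: "f \<in> homog_part n d \<Longrightarrow> g \<in> homog_part n d \<Longrightarrow> f + g \<in> homog_part n d"
  using Poly_Mapping.keys_add[of f g] by (fastforce simp: homog_part_def)

lemma sum_homog_part: "(\<And>i. i \<in> A \<Longrightarrow> f i \<in> homog_part n d) \<Longrightarrow> sum f A \<in> homog_part n d"
  by (induction A rule: infinite_finite_induct) (auto simp: add_homog_part)

lemma mult_homog_part:
  assumes "f \<in> homog_part n d" "g \<in> homog_part n e"
  shows "f * g \<in> homog_part n (d + e)"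
proof -
  have "mon_degree w = d + e" if "w \<in> Poly_Mapping.keys (f * g)" for w
  proof -
    obtain u v where "w = u + v" "u \<in> Poly_Mapping.keys f" "v \<in> Poly_Mapping.keys g"
      using \<open>w \<in> Poly_Mapping.keys (f * g)\<close> Poly_Mapping.keys_mult[of f g] by blast
    then show ?thesis using assms by (simp add: homog_part_def mon_degree_add)
  qed
  with assms show ?thesis by (auto simp: homog_part_def)
qed

lemma const_pol_homog_part [simp]: "const_pol c \<in> homog_part n 0"
  by (auto simp: homog_part_def const_pol_def carrier_poly_ring mon_degree_def)

lemma indet_power_homog_part: "i \<le> n \<Longrightarrow> indet i ^ k \<in> homog_part n k"
  by (auto simp: homog_part_def indet_power_carrier) (simp add: indet_power)


subsection \<open>Polynomials in the last variable\<close>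

text \<open>For \<open>N = Suc n\<close> this is the isomorphism of R_(n+1) with R_n[X_(n+1)].
  Coefficients keep the type \<open>'a mpol\<close>, so that a coefficient lies in R_n is a plain
  membership statement.\<close>

definition upoly :: "nat \<Rightarrow> 'a::field mpol \<Rightarrow> 'a mpol poly" where
  "upoly N f = (\<Sum>u \<in> Poly_Mapping.keys f.
     monom (Poly_Mapping.single (u - Poly_Mapping.single N (Poly_Mapping.lookup u N))
       (Poly_Mapping.lookup f u)) (Poly_Mapping.lookup u N))"

lemma minus_single_add:
  fixes u :: "nat \<Rightarrow>\<^sub>0 nat"
  shows "u - Poly_Mapping.single N (Poly_Mapping.lookup u N)
    + Poly_Mapping.single N (Poly_Mapping.lookup u N) = u"
  by (rule poly_mapping_eqI) (auto simp: lookup_add lookup_minus lookup_single when_def)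

text \<open>Multiplying by the stripped power of X_N restores each monomial, so substituting X_N is
  a left inverse of \<open>upoly N\<close>.\<close>

lemma poly_upoly: "poly (upoly N f) (indet N) = f"
  by (simp add: upoly_def poly_sum poly_monom indet_power mult_single minus_single_add
      flip: poly_mapping_sum_single)

lemma upoly_zero [simp]: "upoly N 0 = 0"
  by (simp add: upoly_def)

lemma upoly_add: "upoly N (f + g) = upoly N f + upoly N g"
  unfolding upoly_def
  by (rule setsum_keys_plus_distrib) (auto simp: single_add add_monom)

lemma upoly_sum: "upoly N (sum f A) = (\<Sum>i \<in> A. upoly N (f i))"
  by (induction A rule: infinite_finite_induct) (auto simp: upoly_add)

lemma upoly_single:
  "upoly N (Poly_Mapping.single u c) =
    monom (Poly_Mapping.single (u - Poly_Mapping.single N (Poly_Mapping.lookup u N)) c)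
      (Poly_Mapping.lookup u N)"
  by (cases "c = 0") (auto simp: upoly_def)

text \<open>Since \<open>g\<close> is free of X_(n+1), every monomial of the product has exponent
  exactly \<open>k\<close> there, and stripping it gives back the monomial of
  \<open>g\<close>.\<close>

lemma upoly_mult_power:
  assumes "g \<in> carrier (poly_ring n)"
  shows "upoly (Suc n) (g * indet (Suc n) ^ k) = monom g k"
proof -
  have "Poly_Mapping.lookup u (Suc n) = 0" if "u \<in> Poly_Mapping.keys g" for u
    using that assms by (fastforce simp: carrier_poly_ring in_keys_iff)
  then have *: "upoly (Suc n) (Poly_Mapping.single u c * indet (Suc n) ^ k) =
      monom (Poly_Mapping.single u c) k" if "u \<in> Poly_Mapping.keys g" for u c
    using that by (simp add: indet_power mult_single upoly_single lookup_add)
  have "upoly (Suc n) (g * indet (Suc n) ^ k) = (\<Sum>u \<in> Poly_Mapping.keys g.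
      monom (Poly_Mapping.single u (Poly_Mapping.lookup g u)) k)"
    by (subst (1) poly_mapping_sum_single[of g]) (simp add: sum_distrib_right upoly_sum *)
  also have "\<dots> = monom (\<Sum>u \<in> Poly_Mapping.keys g.
      Poly_Mapping.single u (Poly_Mapping.lookup g u)) k"
    by (rule poly_eqI) (simp add: coeff_sum)
  finally show ?thesis by (simp flip: poly_mapping_sum_single)
qed

lemma upoly_poly:
  assumes "\<And>k. coeff p k \<in> carrier (poly_ring n)"
  shows "upoly (Suc n) (poly p (indet (Suc n))) = p"
  by (simp add: poly_altdef upoly_sum upoly_mult_power assms poly_as_sum_of_monoms)

text \<open>Traces each monomial of a coefficient back to a monomial of \<open>f\<close>; the
  variables and the degree of the coefficients are both read off from this.\<close>

lemma keys_coeff_upoly: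
  assumes "w \<in> Poly_Mapping.keys (coeff (upoly N f) k)"
  obtains u where "u \<in> Poly_Mapping.keys f" "Poly_Mapping.lookup u N = k"
    "w + Poly_Mapping.single N k = u" "Poly_Mapping.lookup w N = 0"
proof -
  have "w \<in> (\<Union>u \<in> Poly_Mapping.keys f. Poly_Mapping.keys (coeff (monom
      (Poly_Mapping.single (u - Poly_Mapping.single N (Poly_Mapping.lookup u N))
       (Poly_Mapping.lookup f u)) (Poly_Mapping.lookup u N)) k))"
    using assms unfolding upoly_def coeff_sum by (rule subsetD[OF Poly_Mapping.keys_sum])
  then obtain u where u: "u \<in> Poly_Mapping.keys f"
    and w: "w \<in> Poly_Mapping.keys (coeff (monom
      (Poly_Mapping.single (u - Poly_Mapping.single N (Poly_Mapping.lookup u N))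
       (Poly_Mapping.lookup f u)) (Poly_Mapping.lookup u N)) k)"
    by blast
  from w have k: "Poly_Mapping.lookup u N = k"
    and w: "w = u - Poly_Mapping.single N (Poly_Mapping.lookup u N)"
    by (simp_all split: if_splits)
  show ?thesis
    using that[OF u k] minus_single_add[of u N] by (simp add: w k lookup_minus)
qed

lemma coeff_upoly_carrier:
  assumes "f \<in> carrier (poly_ring (Suc n))"
  shows "coeff (upoly (Suc n) f) k \<in> carrier (poly_ring n)"
  unfolding carrier_poly_ring
proof
  fix w assume "w \<in> Poly_Mapping.keys (coeff (upoly (Suc n) f) k)"
  then obtain u where u: "u \<in> Poly_Mapping.keys f" "w + Poly_Mapping.single (Suc n) k = u"
    "Poly_Mapping.lookup w (Suc n) = 0"
    by (rule keys_coeff_upoly)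
  have "Poly_Mapping.keys w \<subseteq> Poly_Mapping.keys u"
    using u(2) by (auto simp: in_keys_iff lookup_add)
  also have "\<dots> \<subseteq> {..Suc n}"
    using assms u(1) by (auto simp: carrier_poly_ring)
  finally have "Poly_Mapping.keys w \<subseteq> {..Suc n}" .
  moreover have "Suc n \<notin> Poly_Mapping.keys w"
    using u(3) by (simp add: in_keys_iff)
  ultimately show "Poly_Mapping.keys w \<subseteq> {..n}"
    unfolding atMost_Suc by blast
qed

text \<open>Stripping the \<open>k\<close>-th power of X_(n+1) lowers the degree by
  \<open>k\<close>. For \<open>k > d\<close> the subtraction truncates, but then the coefficient is
  0, which counts as a form of every degree.\<close>

lemma coeff_upoly_homog_part:
  assumes "f \<in> homog_part (Suc n) d"
  shows "coeff (upoly (Suc n) f) k \<in> homog_part n (d - k)"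
    and "d < k \<Longrightarrow> coeff (upoly (Suc n) f) k = 0"
proof -
  have *: "mon_degree w + k = d" if "w \<in> Poly_Mapping.keys (coeff (upoly (Suc n) f) k)" for w
    using that
  proof (rule keys_coeff_upoly)
    fix u assume "u \<in> Poly_Mapping.keys f" "w + Poly_Mapping.single (Suc n) k = u"
    then show ?thesis
      using assms mon_degree_add[of w "Poly_Mapping.single (Suc n) k"]
      by (auto simp: homog_part_def)
  qed
  show "coeff (upoly (Suc n) f) k \<in> homog_part n (d - k)"
    unfolding homog_part_def mem_Collect_eq
  proof (intro conjI ballI)
    show "coeff (upoly (Suc n) f) k \<in> carrier (poly_ring n)"
      by (rule coeff_upoly_carrier[OF homog_part_carrier[OF assms]])
  qed (use * in fastforce)
  show "coeff (upoly (Suc n) f) k = 0" if "d < k"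
  proof -
    have "Poly_Mapping.keys (coeff (upoly (Suc n) f) k) = {}"
      using * \<open>d < k\<close> by (metis equals0I not_add_less2)
    then show ?thesis by simp
  qed
qed

text \<open>The right-hand side has coefficients in R_n and takes the value \<open>f * g\<close> at
  X_(n+1), so \<open>upoly_poly\<close> identifies it without any computation with
  monomials.\<close>

lemma upoly_mult:
  assumes "f \<in> carrier (poly_ring (Suc n))" "g \<in> carrier (poly_ring (Suc n))"
  shows "upoly (Suc n) (f * g) = upoly (Suc n) f * upoly (Suc n) g"
proof -
  have "coeff (upoly (Suc n) f * upoly (Suc n) g) k \<in> carrier (poly_ring n)" for k
    unfolding coeff_mult using assms by (intro sum_carrier mult_carrier coeff_upoly_carrier)
  from upoly_poly[of _ n, OF this] show ?thesis
    by (simp add: poly_upoly)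
qed

subsection \<open>Powers of the ideal of a point\<close>

text \<open>Natural exponents let truncated subtraction express the convention that a nonpositive
  power is the whole ring.\<close>

definition point_pow :: "nat \<Rightarrow> (nat \<Rightarrow> 'a::field) set \<Rightarrow> nat \<Rightarrow> 'a mpol set" where
  "point_pow n p r = point_ideal n p [^]\<^bsub>ideals_set (poly_ring n)\<^esub> r"

lemma point_ideal_generators_carrier:
  "{f. (\<exists>d. f \<in> homog_part n d) \<and> (\<forall>a \<in> p. eval_pol f a = 0)} \<subseteq> carrier (poly_ring n)"
  by (auto simp: homog_part_def)

lemma ideal_point_ideal: "ideal (point_ideal n p) (poly_ring n)"
  unfolding point_ideal_def
  by (rule poly_ring.genideal_ideal) (rule point_ideal_generators_carrier)

lemma point_idealI: "f \<in> homog_part n d \<Longrightarrow> \<forall>a \<in> p. eval_pol f a = 0 \<Longrightarrow> f \<in> point_ideal n p"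
  unfolding point_ideal_def
  by (rule subsetD[OF poly_ring.genideal_self[OF point_ideal_generators_carrier]]) blast

lemma point_ideal_minimal:
  assumes "ideal J (poly_ring n)"
    and "\<And>f d. f \<in> homog_part n d \<Longrightarrow> \<forall>a \<in> p. eval_pol f a = 0 \<Longrightarrow> f \<in> J"
  shows "point_ideal n p \<subseteq> J"
  unfolding point_ideal_def by (rule poly_ring.genideal_minimal) (use assms in auto)

lemma point_pow_0 [simp]: "point_pow n p 0 = carrier (poly_ring n)"
  by (simp add: point_pow_def ideals_set_def)

lemma point_pow_Suc:
  "point_pow n p (Suc r) = ideal_prod (poly_ring n) (point_pow n p r) (point_ideal n p)"
  by (simp add: point_pow_def ideals_set_def nat_pow_def)

lemma ideal_point_pow: "ideal (point_pow n p r) (poly_ring n)"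
proof (induction r)
  case 0
  show ?case by (simp add: poly_ring.oneideal)
next
  case (Suc r)
  then show ?case unfolding point_pow_Suc
    by (intro poly_ring.ideal_prod_is_ideal ideal_point_ideal)
qed

lemma point_pow_1: "point_pow n p 1 = point_ideal n p"
proof -
  interpret comm_monoid "ideals_set (poly_ring n)"
    by (rule poly_ring.ideals_set_is_comm_monoid)
  show ?thesis
    unfolding point_pow_def
    using ideal_point_ideal[of n p] by (intro nat_pow_eone) (simp add: ideals_set_def)
qed

text \<open>This is the law of exponents in the commutative monoid of ideals, read on
  elements.\<close>

lemma point_pow_mult:
  assumes "f \<in> point_pow n p a" "g \<in> point_pow n p b"
  shows "f * g \<in> point_pow n p (a + b)"
proof -
  interpret comm_monoid "ideals_set (poly_ring n)"
    by (rule poly_ring.ideals_set_is_comm_monoid)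
  have "point_ideal n p \<in> carrier (ideals_set (poly_ring n))"
    using ideal_point_ideal[of n p] by (simp add: ideals_set_def)
  from nat_pow_mult[OF this, of a b]
  have "point_pow n p (a + b) = ideal_prod (poly_ring n) (point_pow n p a) (point_pow n p b)"
    by (simp add: point_pow_def ideals_set_def)
  with ideal_prod.prod[OF assms, where R = "poly_ring n"] show ?thesis by simp
qed

lemma point_pow_antimono:
  assumes "a \<le> b"
  shows "point_pow n p b \<subseteq> point_pow n p a"
  using assms
proof (induction b rule: dec_induct)
  case (step b)
  have "point_pow n p (Suc b) \<subseteq> point_pow n p b"
    unfolding point_pow_Suc
    using poly_ring.ideal_prod_inter[OF ideal_point_pow[of n p b] ideal_point_ideal[of n p]] by blast
  with step show ?case by blast
qed auto

text \<open>For a fixed vector \<open>a\<close>, the polynomials vanishing at \<open>a\<close> form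
  an ideal that contains all generators.\<close>

lemma point_ideal_vanishes:
  assumes "f \<in> point_ideal n p" "a \<in> p"
  shows "eval_pol f a = 0"
proof -
  have "ideal {f \<in> carrier (poly_ring n). eval_pol f a = 0} (poly_ring n)"
    by (rule ideal_poly_ringI) (auto simp: eval_pol_add eval_pol_mult)
  from point_ideal_minimal[OF this, of p] show ?thesis
    using assms by (auto simp: homog_part_def)
qed


subsection \<open>The embedding of a hyperplane\<close>

lemma eval_pol_cong:
  assumes "f \<in> carrier (poly_ring n)" "\<And>i. i \<le> n \<Longrightarrow> a i = b i"
  shows "eval_pol f a = eval_pol f b"
  unfolding eval_pol_def
proof (intro sum.cong refl arg_cong2[where f = "(*)"] prod.cong)
  fix u i assume "u \<in> Poly_Mapping.keys f" "i \<in> Poly_Mapping.keys u"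
  then have "i \<le> n" using assms(1) by (auto simp: carrier_poly_ring)
  then show "a i ^ Poly_Mapping.lookup u i = b i ^ Poly_Mapping.lookup u i"
    by (simp add: assms(2))
qed

context
  fixes n :: nat and p :: "(nat \<Rightarrow> 'a::field) set"
begin

abbreviation embedded :: "(nat \<Rightarrow> 'a) set" where
  "embedded \<equiv> proj_embed n (Suc n) p"

text \<open>A polynomial of R_n sees only the coordinates 0 to n, which the embedding leaves
  unchanged.\<close>

lemma eval_pol_embedded:
  assumes "f \<in> carrier (poly_ring n)"
  shows "(\<forall>a \<in> embedded. eval_pol f a = 0) \<longleftrightarrow> (\<forall>a \<in> p. eval_pol f a = 0)"
proof -
  have "eval_pol f (\<lambda>i \<in> {..Suc n}. if i \<le> n then a i else 0) = eval_pol f a" for a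
    by (rule eval_pol_cong[OF assms]) simp
  then show ?thesis by (simp add: proj_embed_def)
qed

lemma indet_in_embedded_ideal: "indet (Suc n) \<in> point_ideal (Suc n) embedded"
proof (rule point_idealI)
  show "indet (Suc n) \<in> homog_part (Suc n) 1"
    using indet_power_homog_part[of "Suc n" "Suc n" 1] by simp
  show "\<forall>a \<in> embedded. eval_pol (indet (Suc n)) a = 0"
    by (auto simp: proj_embed_def)
qed

text \<open>The contraction to R_n of the ideal of the embedded point is an ideal of R_n and
  contains the generators of the ideal of \<open>p\<close>.\<close>

lemma point_ideal_embedded: "point_ideal n p \<subseteq> point_ideal (Suc n) embedded"
proof -
  let ?J = "carrier (poly_ring n) \<inter> point_ideal (Suc n) embedded"
  note id = ideal_poly_ringD[OF ideal_point_ideal[of "Suc n" embedded]]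
  have "ideal ?J (poly_ring n)"
    by (rule ideal_poly_ringI)
      (use id(2,3) id(4)[OF subsetD[OF poly_ring_mono[of n "Suc n"]]] in auto)
  moreover have "f \<in> ?J" if "f \<in> homog_part n d" "\<forall>a \<in> p. eval_pol f a = 0" for f d
    using that point_idealI[of f "Suc n" d embedded] homog_part_mono[of n "Suc n" d]
      eval_pol_embedded[of f] by (auto simp: homog_part_carrier)
  ultimately show ?thesis using point_ideal_minimal[of ?J n p] by blast
qed

lemma point_pow_embedded: "point_pow n p r \<subseteq> point_pow (Suc n) embedded r"
proof (induction r)
  case 0
  show ?case by (simp add: poly_ring_mono)
next
  case (Suc r)
  show ?case
  proof
    fix f assume "f \<in> point_pow n p (Suc r)"
    then show "f \<in> point_pow (Suc n) embedded (Suc r)"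
      unfolding point_pow_Suc
    proof (induction f rule: ideal_prod.induct)
      case (prod i j)
      then show ?case
        using ideal_prod.prod[of i "point_pow (Suc n) embedded r" j "point_ideal (Suc n) embedded"
            "poly_ring (Suc n)"] Suc point_ideal_embedded by auto
    next
      case (sum f g)
      then show ?case using ideal_prod.sum[OF sum(3,4)] by simp
    qed
  qed
qed

lemma indet_pow_embedded: "indet (Suc n) ^ k \<in> point_pow (Suc n) embedded k"
proof (induction k)
  case (Suc k)
  from point_pow_mult[OF _ this, of "indet (Suc n)" 1, unfolded point_pow_1,
      OF indet_in_embedded_ideal]
  show ?case by (simp only: plus_1_eq_Suc power_Suc)
qed simp

text \<open>The ideal of the embedded point is \<open>(\<wp>, X\<^sub>n\<^sub>+\<^sub>1)\<close>, so its \<open>r\<close>-th power is the direct sum of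
  the \<open>\<wp>\<^sup>r\<^sup>-\<^sup>k X\<^sub>n\<^sub>+\<^sub>1\<^sup>k\<close>; truncated subtraction gives the whole ring for \<open>k \<ge> r\<close>.\<close>

definition graded_pow :: "nat \<Rightarrow> 'a mpol set" where
  "graded_pow r = {f \<in> carrier (poly_ring (Suc n)).
     \<forall>k. coeff (upoly (Suc n) f) k \<in> point_pow n p (r - k)}"

lemma graded_pow_add: "f \<in> graded_pow r \<Longrightarrow> g \<in> graded_pow r \<Longrightarrow> f + g \<in> graded_pow r"
  by (auto simp: graded_pow_def upoly_add intro: ideal_poly_ringD(3)[OF ideal_point_pow])

text \<open>The \<open>k\<close>-th coefficient of the product is a sum of products of coefficients
  with indices \<open>i\<close> and \<open>k - i\<close>, and each summand lies in a high enough
  power.\<close>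

lemma graded_pow_mult:
  assumes "f \<in> graded_pow a" "g \<in> graded_pow b"
  shows "f * g \<in> graded_pow (a + b)"
proof -
  have "coeff (upoly (Suc n) f) i * coeff (upoly (Suc n) g) (k - i) \<in> point_pow n p (a + b - k)"
    if "i \<le> k" for i k
  proof (rule subsetD[OF point_pow_antimono])
    \<comment> \<open>Truncation can only enlarge the right-hand side, so the bound holds even when
      \<open>i > a\<close> or \<open>k - i > b\<close>.\<close>
    show "a + b - k \<le> (a - i) + (b - (k - i))" using that by simp
    show "coeff (upoly (Suc n) f) i * coeff (upoly (Suc n) g) (k - i)
        \<in> point_pow n p (a - i + (b - (k - i)))"
      using assms by (intro point_pow_mult) (auto simp: graded_pow_def)
  qed
  then have "coeff (upoly (Suc n) f * upoly (Suc n) g) k \<in> point_pow n p (a + b - k)" for k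
    unfolding coeff_mult by (intro ideal_sum_closed[OF ideal_point_pow]) auto
  with assms show ?thesis
    by (auto simp: graded_pow_def upoly_mult)
qed

lemma graded_pow_0: "graded_pow 0 = carrier (poly_ring (Suc n))"
  by (auto simp: graded_pow_def coeff_upoly_carrier)

lemma ideal_graded_pow: "ideal (graded_pow r) (poly_ring (Suc n))"
proof (rule ideal_poly_ringI)
  show "0 \<in> graded_pow r"
    by (auto simp: graded_pow_def intro: ideal_poly_ringD(2)[OF ideal_point_pow])
  show "h * f \<in> graded_pow r" if "h \<in> carrier (poly_ring (Suc n))" "f \<in> graded_pow r" for h f
    using graded_pow_mult[of h 0 f r] that by (simp add: graded_pow_0)
qed (auto simp: graded_pow_add, auto simp: graded_pow_def)

text \<open>For exponent 1 only the coefficient with \<open>k = 0\<close> is restricted, and it is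
  the restriction of the form to the hyperplane where X_(n+1) is 0.\<close>

lemma embedded_ideal_subset_graded_pow: "point_ideal (Suc n) embedded \<subseteq> graded_pow 1"
proof (rule point_ideal_minimal[OF ideal_graded_pow])
  fix f :: "'a mpol" and d
  assume f: "f \<in> homog_part (Suc n) d" and van: "\<forall>a \<in> embedded. eval_pol f a = 0"
  let ?c = "coeff (upoly (Suc n) f)"
  have "eval_pol (?c 0) a = 0" if "a \<in> embedded" for a
  proof -
    have "a (Suc n) = 0" using that by (auto simp: proj_embed_def)
    then have *: "eval_pol (indet (Suc n)) a = 0" by simp
    have "f = poly (upoly (Suc n) f) (indet (Suc n))" by (simp add: poly_upoly)
    \<comment> \<open>Splitting off the constant coefficient leaves a multiple of X_(n+1), which
      vanishes at embedded vectors.\<close>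
    then obtain g where "f = ?c 0 + indet (Suc n) * g"
      by (cases "upoly (Suc n) f") auto
    from arg_cong[OF this, of "\<lambda>f. eval_pol f a"] show ?thesis
      using van that * by (simp add: eval_pol_add eval_pol_mult)
  qed
  moreover have c: "?c k \<in> carrier (poly_ring n)" for k
    by (rule coeff_upoly_carrier[OF homog_part_carrier[OF f]])
  ultimately have "\<forall>a \<in> p. eval_pol (?c 0) a = 0"
    using eval_pol_embedded by blast
  then have "?c 0 \<in> point_pow n p (1 - 0)"
    unfolding diff_zero point_pow_1 by (rule point_idealI[OF coeff_upoly_homog_part(1)[OF f]])
  moreover have "?c k \<in> point_pow n p (1 - k)" if "k > 0" for k
    using c that by simp
  ultimately have "?c k \<in> point_pow n p (1 - k)" for k
    by (cases "k = 0") blast+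
  then show "f \<in> graded_pow 1"
    using homog_part_carrier[OF f] by (simp add: graded_pow_def)
qed

text \<open>The factors lie in the powers \<open>r - k\<close> and \<open>k\<close> of the ideal of
  the embedded point. For \<open>k > r\<close> the exponents add up to more than \<open>r\<close>,
  which is harmless as the powers decrease.\<close>

lemma indet_pow_times_embedded:
  assumes "g \<in> point_pow n p (r - k)"
  shows "g * indet (Suc n) ^ k \<in> point_pow (Suc n) embedded r"
proof -
  have "g * indet (Suc n) ^ k \<in> point_pow (Suc n) embedded (r - k + k)"
    using assms point_pow_embedded indet_pow_embedded by (intro point_pow_mult) auto
  moreover have "r \<le> r - k + k" by simp
  ultimately show ?thesis using point_pow_antimono by blast
qed

text \<open>The first inclusion follows by induction from the case of exponent 1 and
  \<open>graded_pow_mult\<close>; for the second, \<open>f\<close> is written as the sum of its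
  coefficients times powers of X_(n+1).\<close>

lemma point_pow_embedded_eq: "point_pow (Suc n) embedded r = graded_pow r"
proof
  show "point_pow (Suc n) embedded r \<subseteq> graded_pow r"
  proof (induction r)
    case 0
    show ?case by (simp add: graded_pow_0)
  next
    case (Suc r)
    show ?case
    proof
      fix f assume "f \<in> point_pow (Suc n) embedded (Suc r)"
      then show "f \<in> graded_pow (Suc r)"
        unfolding point_pow_Suc
      proof (induction f rule: ideal_prod.induct)
        case (prod i j)
        then have "i \<in> graded_pow r" "j \<in> graded_pow 1"
          using Suc embedded_ideal_subset_graded_pow by auto
        then show ?case using graded_pow_mult[of i r j 1] by simp
      qed (simp add: graded_pow_add)
    qed
  qed
next
  show "graded_pow r \<subseteq> point_pow (Suc n) embedded r"
  proof
    fix f assume f: "f \<in> graded_pow r"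
    let ?p = "upoly (Suc n) f"
    have "(\<Sum>k \<le> degree ?p. coeff ?p k * indet (Suc n) ^ k) \<in> point_pow (Suc n) embedded r"
      using f by (intro ideal_sum_closed[OF ideal_point_pow] indet_pow_times_embedded)
        (simp add: graded_pow_def)
    then show "f \<in> point_pow (Suc n) embedded r"
      by (simp add: poly_upoly flip: poly_altdef)
  qed
qed

end

section \<open>Ideals of fat points and of their embeddings\<close>

lemma fat_ideal_iff:
  "f \<in> fat_ideal n s P r \<longleftrightarrow>
    f \<in> carrier (poly_ring n) \<and> (\<forall>j \<in> {1..s}. f \<in> point_pow n (P j) (nat (r j)))"
  by (auto simp: fat_ideal_def point_ideal_pow_def point_pow_def)

lemma ideal_fat_ideal:
  fixes P :: "nat \<Rightarrow> (nat \<Rightarrow> 'a::field) set"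
  shows "ideal (fat_ideal n s P r) (poly_ring n)"
proof (rule ideal_poly_ringI)
  fix f g :: "'a mpol" assume "f \<in> fat_ideal n s P r" "g \<in> fat_ideal n s P r"
  then show "f + g \<in> fat_ideal n s P r"
    by (auto simp: fat_ideal_iff intro: ideal_poly_ringD(3)[OF ideal_point_pow])
next
  fix h f :: "'a mpol" assume "h \<in> carrier (poly_ring n)" "f \<in> fat_ideal n s P r"
  then show "h * f \<in> fat_ideal n s P r"
    by (auto simp: fat_ideal_iff intro: ideal_poly_ringD(4)[OF ideal_point_pow])
qed (auto simp: fat_ideal_iff intro: ideal_poly_ringD(2)[OF ideal_point_pow])

lemma fat_ideal_embed_iff:
  assumes "f \<in> carrier (poly_ring (Suc n))"
  shows "f \<in> fat_ideal (Suc n) s (\<lambda>j. proj_embed n (Suc n) (P j)) r \<longleftrightarrow>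
    (\<forall>k. coeff (upoly (Suc n) f) k \<in> fat_ideal n s P (\<lambda>j. r j - int k))"
proof -
  \<comment> \<open>The convention for nonpositive exponents agrees with truncated subtraction, also
    for negative \<open>r j\<close>.\<close>
  have "nat (r j - int k) = nat (r j) - k" for j k
    by simp
  then show ?thesis
    using assms coeff_upoly_carrier[OF assms]
    by (auto simp: fat_ideal_iff point_pow_embedded_eq graded_pow_def)
qed

text \<open>The \<open>g k\<close> are the coefficients of the sum in X_(n+1); those beyond
  \<open>t\<close> are 0 and lie in every ideal.\<close>

lemma fat_ideal_embed_sum_iff:
  assumes "\<And>k. k \<le> t \<Longrightarrow> g k \<in> carrier (poly_ring n)"
  shows "(\<Sum>k\<le>t. g k * indet (Suc n) ^ k)
      \<in> fat_ideal (Suc n) s (\<lambda>j. proj_embed n (Suc n) (P j)) r \<longleftrightarrow>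
    (\<forall>k\<le>t. g k \<in> fat_ideal n s P (\<lambda>j. r j - int k))"
proof -
  have "upoly (Suc n) (\<Sum>k\<le>t. g k * indet (Suc n) ^ k) = (\<Sum>k\<le>t. monom (g k) k)"
    using assms by (simp add: upoly_sum upoly_mult_power)
  moreover have "coeff (\<Sum>k\<le>t. monom (g k) k) k = (if k \<le> t then g k else 0)" for k
    by (simp add: coeff_sum)
  moreover have "(\<Sum>k\<le>t. g k * indet (Suc n) ^ k) \<in> carrier (poly_ring (Suc n))"
    using assms poly_ring_mono[of n "Suc n"]
    by (intro sum_carrier mult_carrier indet_power_carrier) auto
  ultimately show ?thesis
    using ideal_poly_ringD(2)[OF ideal_fat_ideal[of n s P]] by (simp add: fat_ideal_embed_iff)
qed

subsection \<open>Hilbert functions and bases modulo an ideal\<close>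

lemma const_pol_add: "const_pol (a + b) = const_pol a + const_pol b"
  by (simp add: const_pol_def single_add)

lemma const_pol_mult: "const_pol (a * b) = const_pol a * const_pol b"
  by (simp add: const_pol_def mult_single)

lemma const_pol_0 [simp]: "const_pol 0 = 0"
  by (simp add: const_pol_def)

lemma const_pol_1 [simp]: "const_pol 1 = 1"
  by (simp add: const_pol_def)

lemma const_pol_uminus: "const_pol (- a) = - const_pol a"
  by (simp add: const_pol_def single_uminus)

lemma const_pol_sum: "const_pol (sum f A) = (\<Sum>i \<in> A. const_pol (f i))"
  by (induction A rule: infinite_finite_induct) (auto simp: const_pol_add)

definition lin_comb :: "'i set \<Rightarrow> ('i \<Rightarrow> 'a::field mpol) \<Rightarrow> ('i \<Rightarrow> 'a) \<Rightarrow> 'a mpol" where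
  "lin_comb A b c = (\<Sum>i \<in> A. const_pol (c i) * b i)"

definition indep_mod :: "'a::field mpol set \<Rightarrow> 'i set \<Rightarrow> ('i \<Rightarrow> 'a mpol) \<Rightarrow> bool" where
  "indep_mod I A b \<longleftrightarrow> (\<forall>c. lin_comb A b c \<in> I \<longrightarrow> (\<forall>i \<in> A. c i = 0))"

text \<open>The \<open>b i\<close> represent a basis of the degree \<open>t\<close> part of R_n/I.
  The index type is free: monomials index the bases in R_n, pairs of an exponent and a monomial
  index those in R_(n+1).\<close>

definition quot_basis ::
  "nat \<Rightarrow> nat \<Rightarrow> 'a::field mpol set \<Rightarrow> 'i set \<Rightarrow> ('i \<Rightarrow> 'a mpol) \<Rightarrow> bool" where
  "quot_basis n t I A b \<longleftrightarrow> finite A \<and> (\<forall>i \<in> A. b i \<in> homog_part n t) \<and> indep_mod I A b \<and>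
     (\<forall>w \<in> homog_part n t. \<exists>c. w - lin_comb A b c \<in> I)"

lemma lin_comb_cong: "(\<And>i. i \<in> A \<Longrightarrow> c i = d i) \<Longrightarrow> lin_comb A b c = lin_comb A b d"
  by (simp add: lin_comb_def)

lemma lin_comb_insert:
  "finite A \<Longrightarrow> i \<notin> A \<Longrightarrow> lin_comb (insert i A) b c = const_pol (c i) * b i + lin_comb A b c"
  by (simp add: lin_comb_def)

lemma lin_comb_uminus: "lin_comb A b (\<lambda>i. - c i) = - lin_comb A b c"
  by (simp add: lin_comb_def const_pol_uminus sum_negf)

lemma lin_comb_scale: "lin_comb A b (\<lambda>i. a * c i) = const_pol a * lin_comb A b c"
  by (simp add: lin_comb_def const_pol_mult sum_distrib_left mult_ac)

lemma lin_comb_sum: "lin_comb A b (\<lambda>i. \<Sum>j \<in> B. c j i) = (\<Sum>j \<in> B. lin_comb A b (c j))"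
  unfolding lin_comb_def const_pol_sum sum_distrib_right by (rule sum.swap)

lemma lin_comb_carrier:
  "(\<And>i. i \<in> A \<Longrightarrow> b i \<in> carrier (poly_ring n)) \<Longrightarrow> lin_comb A b c \<in> carrier (poly_ring n)"
  unfolding lin_comb_def by (intro sum_carrier mult_carrier) auto

lemma lin_comb_homog_part:
  assumes "\<And>i. i \<in> A \<Longrightarrow> b i \<in> homog_part n t"
  shows "lin_comb A b c \<in> homog_part n t"
  unfolding lin_comb_def
  using assms mult_homog_part[OF const_pol_homog_part] by (fastforce intro: sum_homog_part)

section \<open>Existence of bases modulo an ideal\<close>

lemma indep_mod_insert:
  assumes I: "ideal I (poly_ring n)" and fin: "finite A" "i \<notin> A" and indep: "indep_mod I A b"
    and new: "\<nexists>c. b i - lin_comb A b c \<in> I"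
  shows "indep_mod I (insert i A) b"
  unfolding indep_mod_def
proof (intro allI impI)
  fix c assume c: "lin_comb (insert i A) b c \<in> I"
  have "c i = 0"
  proof (rule ccontr)
    assume nz: "c i \<noteq> 0"
    \<comment> \<open>Dividing the relation by \<open>c i\<close> exhibits \<open>b i\<close> as a
      combination of the others modulo \<open>I\<close>, with these coefficients.\<close>
    have scale: "lin_comb A b (\<lambda>j. - (1 / c i * c j)) = - (const_pol (1 / c i) * lin_comb A b c)"
      by (simp only: lin_comb_uminus lin_comb_scale)
    have "const_pol (1 / c i) * lin_comb (insert i A) b c \<in> I"
      by (rule ideal_poly_ringD(4)[OF I _ c]) simp
    also have "const_pol (1 / c i) * lin_comb (insert i A) b c =
        b i - lin_comb A b (\<lambda>j. - (1 / c i * c j))"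
      unfolding scale using nz fin
      by (simp add: lin_comb_insert distrib_left flip: mult.assoc const_pol_mult)
    finally show False using new by blast
  qed
  with c fin have "lin_comb A b c \<in> I"
    by (simp add: lin_comb_insert)
  with indep \<open>c i = 0\<close> show "\<forall>j \<in> insert i A. c j = 0"
    by (auto simp: indep_mod_def)
qed

text \<open>Going through \<open>M\<close>, an element is kept exactly when it is not yet a
  combination modulo \<open>I\<close> of those already kept.\<close>

lemma exists_indep_mod:
  assumes I: "ideal I (poly_ring n)" and "finite M"
  shows "\<exists>A \<subseteq> M. indep_mod I A b \<and> (\<forall>i \<in> M. \<exists>c. b i - lin_comb A b c \<in> I)"
  using \<open>finite M\<close>
proof (induction M)
  case (insert i M)
  then obtain A where A: "A \<subseteq> M" "indep_mod I A b" "\<forall>i \<in> M. \<exists>c. b i - lin_comb A b c \<in> I"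
    by blast
  show ?case
  proof (cases "\<exists>c. b i - lin_comb A b c \<in> I")
    case True
    with A show ?thesis by (intro exI[of _ A]) auto
  next
    case False
    have fin: "finite A" "i \<notin> A"
      using A(1) insert.hyps finite_subset by auto
    have "\<exists>c. b j - lin_comb (insert i A) b c \<in> I" if "j \<in> insert i M" for j
    proof (cases "j = i")
      case True
      have "lin_comb A b ((\<lambda>_. 0)(i := 1)) = lin_comb A b (\<lambda>_. 0)"
        using fin by (intro lin_comb_cong) auto
      then have "b i - lin_comb (insert i A) b ((\<lambda>_. 0)(i := 1)) = 0"
        using fin by (simp add: lin_comb_insert) (simp add: lin_comb_def)
      then show ?thesis
        using True ideal_poly_ringD(2)[OF I] by metis
    next
      case j: False
      then obtain c where c: "b j - lin_comb A b c \<in> I" using A(3) \<open>j \<in> insert i M\<close> by blast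
      have "lin_comb (insert i A) b (c(i := 0)) = lin_comb A b (c(i := 0))"
        using fin by (simp add: lin_comb_insert)
      also have "\<dots> = lin_comb A b c"
        using fin by (intro lin_comb_cong) auto
      finally show ?thesis using c by metis
    qed
    then show ?thesis
      using indep_mod_insert[OF I fin A(2) False] A(1) by (intro exI[of _ "insert i A"]) auto
  qed
qed (auto simp: indep_mod_def)

text \<open>Restricting exponent vectors to \<open>{..n}\<close> is injective here, and each
  exponent is at most the degree \<open>t\<close>.\<close>

lemma finite_mons: "finite {u. Poly_Mapping.keys u \<subseteq> {..n} \<and> mon_degree u = t}"
proof (rule finite_imageD)
  let ?U = "{u. Poly_Mapping.keys u \<subseteq> {..n} \<and> mon_degree u = t}"
  let ?h = "\<lambda>u. restrict (Poly_Mapping.lookup u) {..n}"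
  show "finite (?h ` ?U)"
  proof (rule finite_subset)
    have "Poly_Mapping.lookup u i \<le> t" if "u \<in> ?U" "i \<le> n" for u i
      using that member_le_sum[of i "{..n}" "Poly_Mapping.lookup u"]
        mon_degree_superset[of "{..n}" u] by auto
    then show "?h ` ?U \<subseteq> {..n} \<rightarrow>\<^sub>E {..t}"
      by (intro image_subsetI) (simp add: restrict_PiE_iff)
    show "finite ({..n} \<rightarrow>\<^sub>E {..t})"
      by (intro finite_PiE) auto
  qed
  show "inj_on ?h ?U"
  proof (rule inj_onI)
    fix u v assume uv: "u \<in> ?U" "v \<in> ?U" and eq: "?h u = ?h v"
    show "u = v"
    proof (rule poly_mapping_eqI)
      fix i
      show "Poly_Mapping.lookup u i = Poly_Mapping.lookup v i"
      proof (cases "i \<le> n")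
        case True
        then show ?thesis using fun_cong[OF eq, of i] by simp
      next
        case False
        then have "i \<notin> Poly_Mapping.keys u" "i \<notin> Poly_Mapping.keys v" using uv by auto
        then show ?thesis by (simp add: in_keys_iff)
      qed
    qed
  qed
qed

text \<open>The finitely many monomials of degree \<open>t\<close> span the forms of degree
  \<open>t\<close>, so a basis can be selected among them.\<close>

lemma exists_quot_basis:
  fixes I :: "'a::field mpol set"
  assumes I: "ideal I (poly_ring n)"
  shows "\<exists>A (b :: (nat \<Rightarrow>\<^sub>0 nat) \<Rightarrow> 'a mpol). quot_basis n t I A b"
proof -
  let ?U = "{u. Poly_Mapping.keys u \<subseteq> {..n} \<and> mon_degree u = t}"
  define b where "b = (\<lambda>u :: nat \<Rightarrow>\<^sub>0 nat. Poly_Mapping.single u (1 :: 'a))"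
  obtain A where A: "A \<subseteq> ?U" "indep_mod I A b" "\<forall>u \<in> ?U. \<exists>c. b u - lin_comb A b c \<in> I"
    using exists_indep_mod[OF I finite_mons, of n t b] by blast
  from A(3) obtain c where c: "\<And>u. u \<in> ?U \<Longrightarrow> b u - lin_comb A b (c u) \<in> I"
    by metis
  have span: "\<exists>d. w - lin_comb A b d \<in> I" if w: "w \<in> homog_part n t" for w
  proof -
    let ?l = "Poly_Mapping.lookup w"
    \<comment> \<open>The relations for the single monomials are added with the coefficients of
      \<open>w\<close> as weights.\<close>
    have "(\<Sum>u \<in> Poly_Mapping.keys w. const_pol (?l u) * (b u - lin_comb A b (c u))) \<in> I"
      by (rule ideal_sum_closed[OF I], rule ideal_poly_ringD(4)[OF I const_pol_carrier], rule c)
        (use w in \<open>auto simp: homog_part_def carrier_poly_ring\<close>)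
    also have "(\<Sum>u \<in> Poly_Mapping.keys w. const_pol (?l u) * (b u - lin_comb A b (c u))) =
        (\<Sum>u \<in> Poly_Mapping.keys w. const_pol (?l u) * b u)
        - lin_comb A b (\<lambda>i. \<Sum>u \<in> Poly_Mapping.keys w. ?l u * c u i)"
      by (simp add: lin_comb_sum lin_comb_scale right_diff_distrib sum_subtractf)
    also have "(\<Sum>u \<in> Poly_Mapping.keys w. const_pol (?l u) * b u) = w"
      by (simp add: const_pol_def b_def mult_single flip: poly_mapping_sum_single)
    finally show ?thesis by blast
  qed
  have "quot_basis n t I A b"
    unfolding quot_basis_def
  proof (intro conjI ballI)
    show "finite A" by (rule finite_subset[OF A(1) finite_mons])
    show "b u \<in> homog_part n t" if "u \<in> A" for u
      using that A(1) by (auto simp: b_def homog_part_def carrier_poly_ring)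
  qed (use A(2) span in auto)
  then show ?thesis by blast
qed

section \<open>Dimensions in the quotient ring\<close>

lemma subfield_const_pol: "subfield (range const_pol) (poly_ring n :: 'a::field mpol ring)"
proof (rule poly_ring.subfieldI)
  let ?R = "poly_ring n :: 'a mpol ring"
  show "subcring (range const_pol) ?R"
  proof (rule poly_ring.subcringI', rule poly_ring.subringI)
    show "\<one>\<^bsub>?R\<^esub> \<in> range const_pol"
      by (simp add: image_iff) (metis const_pol_1)
  next
    fix h :: "'a mpol" assume "h \<in> range const_pol"
    then show "\<ominus>\<^bsub>?R\<^esub> h \<in> range const_pol"
      by (auto simp: a_inv_poly_ring simp flip: const_pol_uminus)
  qed (auto simp flip: const_pol_add const_pol_mult)
  show "Units (?R\<lparr>carrier := range const_pol\<rparr>) = range const_pol - {\<zero>\<^bsub>?R\<^esub>}"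
  proof (intro equalityI subsetI)
    fix x assume "x \<in> Units (?R\<lparr>carrier := range const_pol\<rparr>)"
    then obtain y where "x \<in> range const_pol" "y * x = 1"
      by (auto simp: Units_def)
    then show "x \<in> range const_pol - {\<zero>\<^bsub>?R\<^esub>}" by auto
  next
    fix x assume "x \<in> range const_pol - {\<zero>\<^bsub>?R\<^esub>}"
    then obtain c where c: "x = const_pol c" "const_pol c \<noteq> (0 :: 'a mpol)" by auto
    then have "c \<noteq> 0" by auto
    then have "const_pol (1 / c) * x = 1" "x * const_pol (1 / c) = 1"
      using c(1) by (simp_all flip: const_pol_mult)
    with c(1) show "x \<in> Units (?R\<lparr>carrier := range const_pol\<rparr>)"
      by (auto simp: Units_def)
  qed
qed

context
  fixes n :: nat and I :: "'a::field mpol set"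
  assumes I: "ideal I (poly_ring n)"
begin

abbreviation (input) quot_map :: "'a mpol \<Rightarrow> 'a mpol set" where
  "quot_map f \<equiv> I +>\<^bsub>poly_ring n\<^esub> f"

interpretation quot: ring_hom_ring "poly_ring n" "poly_ring n Quot I" quot_map
  by (rule ideal.rcos_ring_hom_ring[OF I])

lemma quot_map_eq_iff:
  assumes "f \<in> carrier (poly_ring n)" "g \<in> carrier (poly_ring n)"
  shows "quot_map f = quot_map g \<longleftrightarrow> f - g \<in> I"
proof -
  have d: "f - g \<in> carrier (poly_ring n)"
    using assms poly_ring.minus_closed[of f n g] by (simp add: a_minus_poly_ring)
  have "quot_map ((f - g) + g) = quot_map (f - g) \<oplus>\<^bsub>poly_ring n Quot I\<^esub> quot_map g"
    using quot.hom_add[OF d assms(2)] by simp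
  then have "quot_map f = quot_map g \<longleftrightarrow> quot_map (f - g) = \<zero>\<^bsub>poly_ring n Quot I\<^esub>"
    using quot.S.add.r_cancel_one[OF quot.hom_closed[OF assms(2)] quot.hom_closed[OF d]] by simp
  also have "\<dots> \<longleftrightarrow> f - g \<in> I"
    using ideal.rcos_const_imp_mem[OF I d] poly_ring.a_rcos_zero[OF I, of "f - g"]
    by (auto simp: FactRing_def)
  finally show ?thesis .
qed

text \<open>Each new basis element extends the span by a line, which is how \<open>dimension\<close>
  is defined inductively.\<close>

lemma dimension_lin_combs:
  assumes "finite A" "\<And>i. i \<in> A \<Longrightarrow> b i \<in> carrier (poly_ring n)" "indep_mod I A b"
  shows "quot.S.dimension (card A) (quot_map ` range const_pol)
    (quot_map ` range (lin_comb A b))"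
  using assms
proof (induction A)
  case empty
  have "range (lin_comb {} b) = {0}" by (auto simp: lin_comb_def)
  then show ?case using quot.hom_zero by simp
next
  case (insert i A)
  let ?K = "quot_map ` range const_pol"
  let ?E = "quot_map ` range (lin_comb A b)"
  \<comment> \<open>A relation over \<open>A\<close> becomes one over \<open>insert i A\<close> by
    giving \<open>i\<close> the coefficient 0.\<close>
  have indep: "indep_mod I A b"
    unfolding indep_mod_def
  proof (intro allI impI)
    fix c assume "lin_comb A b c \<in> I"
    also have "lin_comb A b c = lin_comb A b (c(i := 0))"
      using insert.hyps by (intro lin_comb_cong) auto
    also have "\<dots> = lin_comb (insert i A) b (c(i := 0))"
      using insert.hyps by (simp add: lin_comb_insert)
    finally have "\<forall>j \<in> insert i A. (c(i := 0)) j = 0"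
      using insert.prems(2) unfolding indep_mod_def by blast
    then show "\<forall>j \<in> A. c j = 0"
      using insert.hyps by (metis fun_upd_other insertCI)
  qed
  have carr: "lin_comb A b c \<in> carrier (poly_ring n)" for c
    using insert.prems(1) by (intro lin_comb_carrier) auto
  have bi: "b i \<in> carrier (poly_ring n)"
    using insert.prems(1) by auto
  \<comment> \<open>If the class of \<open>b i\<close> were in the span of the others, there would
    be a relation with coefficient 1 at \<open>i\<close>.\<close>
  have new: "quot_map (b i) \<notin> ?E"
  proof
    assume "quot_map (b i) \<in> ?E"
    then obtain c where "quot_map (b i) = quot_map (lin_comb A b c)" by blast
    then have "b i - lin_comb A b c \<in> I"
      using quot_map_eq_iff[OF bi carr] by simp
    also have "lin_comb A b c = - lin_comb A b ((\<lambda>j. - c j)(i := 1))"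
      unfolding lin_comb_uminus[symmetric] using insert.hyps by (intro lin_comb_cong) auto
    also have "b i - - lin_comb A b ((\<lambda>j. - c j)(i := 1)) =
        lin_comb (insert i A) b ((\<lambda>j. - c j)(i := 1))"
      using insert.hyps by (simp add: lin_comb_insert)
    finally show False
      using insert.prems(2) by (fastforce simp: indep_mod_def)
  qed
  have comb: "quot_map (const_pol a * b i + lin_comb A b c) =
      quot_map (const_pol a) \<otimes>\<^bsub>poly_ring n Quot I\<^esub> quot_map (b i)
        \<oplus>\<^bsub>poly_ring n Quot I\<^esub> quot_map (lin_comb A b c)" for a c
  proof -
    have "const_pol a * b i \<in> carrier (poly_ring n)" using bi by auto
    from quot.hom_add[OF this carr] quot.hom_mult[OF _ bi] show ?thesis by simp
  qed
  have ext: "quot.S.line_extension ?K (quot_map (b i)) ?E =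
      quot_map ` range (lin_comb (insert i A) b)"
  proof (intro equalityI subsetI)
    fix x assume "x \<in> quot.S.line_extension ?K (quot_map (b i)) ?E"
    then obtain a c where "x = quot_map (const_pol a * b i + lin_comb A b c)"
      unfolding quot.S.line_extension_mem_iff by (auto simp: comb)
    moreover have "lin_comb A b c = lin_comb A b (c(i := a))"
      using insert.hyps by (intro lin_comb_cong) auto
    then have "const_pol a * b i + lin_comb A b c = lin_comb (insert i A) b (c(i := a))"
      using insert.hyps by (simp add: lin_comb_insert)
    ultimately show "x \<in> quot_map ` range (lin_comb (insert i A) b)" by auto
  next
    fix x assume "x \<in> quot_map ` range (lin_comb (insert i A) b)"
    then obtain c where "x = quot_map (const_pol (c i) * b i + lin_comb A b c)"
      using insert.hyps by (auto simp: lin_comb_insert)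
    then show "x \<in> quot.S.line_extension ?K (quot_map (b i)) ?E"
      unfolding quot.S.line_extension_mem_iff by (auto simp: comb)
  qed
  have "quot.S.dimension (card A) ?K ?E"
    using insert.IH insert.prems(1) indep by auto
  from quot.S.dimension.Suc_dim[OF quot.hom_closed[OF bi] new this]
  show ?case using insert.hyps by (simp add: ext)
qed

text \<open>Modulo \<open>I\<close> the combinations of the basis are exactly the classes of forms
  of degree \<open>t\<close>; what remains is that \<open>dim\<close> picks out the dimension
  \<open>card A\<close>.\<close>

lemma hilbert_fun_quot_basis:
  assumes "quot_basis n t I A b"
  shows "hilbert_fun n I t = card A"
proof -
  let ?Q = "poly_ring n Quot I" and ?K = "quot_map ` range const_pol"
  note basis = assms[unfolded quot_basis_def]
  have b: "b i \<in> carrier (poly_ring n)" if "i \<in> A" for i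
    using basis that homog_part_carrier by blast
  have "quot_map ` range (lin_comb A b) = quot_map ` homog_part n t"
  proof (intro equalityI subsetI)
    fix x assume "x \<in> quot_map ` range (lin_comb A b)"
    then show "x \<in> quot_map ` homog_part n t"
      using basis lin_comb_homog_part[of A b n t] by auto
  next
    fix x assume "x \<in> quot_map ` homog_part n t"
    then obtain w where w: "w \<in> homog_part n t" "x = quot_map w" by blast
    with basis obtain c where "w - lin_comb A b c \<in> I" by blast
    then have "quot_map w = quot_map (lin_comb A b c)"
      using quot_map_eq_iff[OF homog_part_carrier[OF w(1)] lin_comb_carrier[of A b n c]] b
      by simp
    with w show "x \<in> quot_map ` range (lin_comb A b)" by auto
  qed
  with dimension_lin_combs[of A b] basis b
  have dim: "quot.S.dimension (card A) ?K (quot_map ` homog_part n t)" by auto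
  have "quot.S.dim ?K (quot_map ` homog_part n t) = card A"
  \<comment> \<open>Uniqueness of dimension is available over a subfield, and the constants map to
    one only if the quotient is not the zero ring.\<close>
  proof (cases "\<one>\<^bsub>?Q\<^esub> = \<zero>\<^bsub>?Q\<^esub>")
    case False
    from quot.img_is_subfield(2)[OF subfield_const_pol False] dim show ?thesis
      using quot.S.dimI unfolding over_def by blast
  next
    case True
    then have triv: "carrier ?Q = {\<zero>\<^bsub>?Q\<^esub>}"
      by (rule quot.S.one_zeroD)
    \<comment> \<open>In the zero ring no vector lies outside a subspace, so no line extension is
      ever possible and only dimension 0 occurs.\<close>
    have "m = 0 \<and> E = {\<zero>\<^bsub>?Q\<^esub>}" if "quot.S.dimension m L E" for m L E
      using that by (induction rule: quot.S.dimension.induct) (auto simp: triv)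
    then show ?thesis
      using dim unfolding quot.S.dim_def by (metis (no_types, lifting) the_equality)
  qed
  then show ?thesis
    by (simp add: hilbert_fun_def image_image)
qed

end

subsection \<open>The Hilbert function of the embedded fat points\<close>

text \<open>Bases of the degree \<open>t - k\<close> parts modulo the fat ideals lowered by
  \<open>k\<close>, multiplied by the \<open>k\<close>-th power of X_(n+1), together form a basis in
  degree \<open>t\<close>. Counting it gives the sum.\<close>

lemma hilbert_fun_embed:
  fixes P :: "nat \<Rightarrow> (nat \<Rightarrow> 'a::field) set" and r :: "nat \<Rightarrow> int"
  shows "hilbert_fun (Suc n) (fat_ideal (Suc n) s (\<lambda>j. proj_embed n (Suc n) (P j)) r) t =
    (\<Sum>k\<le>t. hilbert_fun n (fat_ideal n s P (\<lambda>j. r j - int k)) (t - k))"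
proof -
  let ?F = "\<lambda>k. fat_ideal n s P (\<lambda>j. r j - int k)"
  let ?I = "fat_ideal (Suc n) s (\<lambda>j. proj_embed n (Suc n) (P j)) r"
  have "\<exists>A b. quot_basis n (t - k) (?F k) (A :: (nat \<Rightarrow>\<^sub>0 nat) set) b" for k
    by (rule exists_quot_basis[OF ideal_fat_ideal])
  then obtain A :: "nat \<Rightarrow> (nat \<Rightarrow>\<^sub>0 nat) set" and b
    where basis: "\<And>k. quot_basis n (t - k) (?F k) (A k) (b k)"
    by metis
  have fin: "finite (A k)" and bk: "i \<in> A k \<Longrightarrow> b k i \<in> homog_part n (t - k)"
    and indep: "indep_mod (?F k) (A k) (b k)"
    and span: "w \<in> homog_part n (t - k) \<Longrightarrow> \<exists>c. w - lin_comb (A k) (b k) c \<in> ?F k" for k i w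
    using basis[of k] by (auto simp: quot_basis_def)
  let ?S = "Sigma {..t} A"
  define B where "B = (\<lambda>(k, i). b k i * indet (Suc n) ^ k)"
  have lin_comb_B: "lin_comb ?S B c =
      (\<Sum>k\<le>t. lin_comb (A k) (b k) (\<lambda>i. c (k, i)) * indet (Suc n) ^ k)" for c
  proof -
    have "lin_comb ?S B c =
        (\<Sum>(k, i) \<in> ?S. const_pol (c (k, i)) * b k i * indet (Suc n) ^ k)"
      by (simp add: lin_comb_def B_def split_def mult.assoc)
    also have "\<dots> = (\<Sum>k\<le>t. \<Sum>i \<in> A k. const_pol (c (k, i)) * b k i * indet (Suc n) ^ k)"
      using fin by (subst sum.Sigma) auto
    finally show ?thesis by (simp add: lin_comb_def sum_distrib_right)
  qed
  have carr: "lin_comb (A k) (b k) c \<in> carrier (poly_ring n)" for k c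
    using bk by (intro lin_comb_carrier homog_part_carrier)
  have "quot_basis (Suc n) t ?I ?S B"
    unfolding quot_basis_def
  proof (intro conjI ballI)
    show "finite ?S" using fin by auto
    show "B x \<in> homog_part (Suc n) t" if "x \<in> ?S" for x
    proof -
      obtain k i where ki: "x = (k, i)" "k \<le> t" "i \<in> A k" using \<open>x \<in> ?S\<close> by auto
      have "b k i \<in> homog_part (Suc n) (t - k)"
        using bk[OF ki(3)] homog_part_mono[of n "Suc n"] by auto
      from mult_homog_part[OF this indet_power_homog_part[of "Suc n" _ k, OF order_refl]]
      show ?thesis using ki by (simp add: B_def)
    qed
    show "indep_mod ?I ?S B"
      unfolding indep_mod_def
    proof (intro allI impI)
      fix c assume "lin_comb ?S B c \<in> ?I"
      then have "\<forall>k\<le>t. lin_comb (A k) (b k) (\<lambda>i. c (k, i)) \<in> ?F k"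
        unfolding lin_comb_B using carr by (subst (asm) fat_ideal_embed_sum_iff) auto
      then show "\<forall>x \<in> ?S. c x = 0"
        using indep unfolding indep_mod_def by fastforce
    qed
    fix w :: "'a mpol" assume w: "w \<in> homog_part (Suc n) t"
    let ?w = "coeff (upoly (Suc n) w)"
    have "\<exists>c. ?w k - lin_comb (A k) (b k) c \<in> ?F k" for k
      by (rule span[OF coeff_upoly_homog_part(1)[OF w]])
    then obtain c where c: "\<And>k. ?w k - lin_comb (A k) (b k) (c k) \<in> ?F k"
      by metis
    \<comment> \<open>The representations of the coefficients of \<open>w\<close> are assembled into
      one of \<open>w\<close>, by the direction of \<open>fat_ideal_embed_sum_iff\<close> opposite
      to the one used for independence.\<close>
    have "(\<Sum>k\<le>t. (?w k - lin_comb (A k) (b k) (c k)) * indet (Suc n) ^ k) \<in> ?I"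
    proof (subst fat_ideal_embed_sum_iff)
      show "?w k - lin_comb (A k) (b k) (c k) \<in> carrier (poly_ring n)" for k
        using c[of k] ideal_poly_ringD(1)[OF ideal_fat_ideal[of n s P]] by blast
    qed (use c in blast)
    also have "(\<Sum>k\<le>t. (?w k - lin_comb (A k) (b k) (c k)) * indet (Suc n) ^ k) =
        (\<Sum>k\<le>t. ?w k * indet (Suc n) ^ k) - lin_comb ?S B (\<lambda>(k, i). c k i)"
      by (simp add: lin_comb_B left_diff_distrib sum_subtractf)
    also have "(\<Sum>k\<le>t. ?w k * indet (Suc n) ^ k) = poly (upoly (Suc n) w) (indet (Suc n))"
    proof -
      \<comment> \<open>A form of degree \<open>t\<close> contains no power of X_(n+1) beyond
        \<open>t\<close>, so the sum up to \<open>t\<close> is all of \<open>w\<close>.\<close>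
      have "degree (upoly (Suc n) w) \<le> t"
        using coeff_upoly_homog_part(2)[OF w] by (intro degree_le) auto
      then show ?thesis
        unfolding poly_altdef by (intro sum.mono_neutral_right) (auto simp: coeff_eq_0)
    qed
    also have "\<dots> = w" by (rule poly_upoly)
    finally show "\<exists>c. w - lin_comb ?S B c \<in> ?I" by blast
  qed
  then have "hilbert_fun (Suc n) ?I t = card ?S"
    by (rule hilbert_fun_quot_basis[OF ideal_fat_ideal])
  also have "\<dots> = (\<Sum>k\<le>t. card (A k))"
    using fin by simp
  also have "\<dots> = (\<Sum>k\<le>t. hilbert_fun n (?F k) (t - k))"
    using hilbert_fun_quot_basis[OF ideal_fat_ideal basis] by simp
  finally show ?thesis .
qed

text \<open>The substitution \<open>i = t - k\<close> turns the previous sum into this one; the term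
  \<open>i = t\<close>, where nothing is lowered, is split off.\<close>

lemma hilbert_fun_embed':
  fixes P :: "nat \<Rightarrow> (nat \<Rightarrow> 'a::field) set" and r :: "nat \<Rightarrow> int"
  shows "hilbert_fun (Suc n) (fat_ideal (Suc n) s (\<lambda>j. proj_embed n (Suc n) (P j)) r) t =
    hilbert_fun n (fat_ideal n s P r) t
      + (\<Sum>i<t. hilbert_fun n (fat_ideal n s P (\<lambda>j. r j - int t + int i)) i)"
proof -
  have "(\<Sum>k\<le>t. hilbert_fun n (fat_ideal n s P (\<lambda>j. r j - int k)) (t - k)) =
      (\<Sum>i\<le>t. hilbert_fun n (fat_ideal n s P (\<lambda>j. r j - int t + int i)) i)"
    by (rule sum.reindex_bij_witness[of _ "\<lambda>i. t - i" "\<lambda>k. t - k"])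
      (auto simp: of_nat_diff algebra_simps)
  also have "\<dots> = hilbert_fun n (fat_ideal n s P r) t
      + (\<Sum>i<t. hilbert_fun n (fat_ideal n s P (\<lambda>j. r j - int t + int i)) i)"
    by (simp flip: lessThan_Suc_atMost)
  finally show ?thesis by (simp add: hilbert_fun_embed)
qed

section \<open>Larger ambient spaces and positivity of Hilbert functions\<close>

lemma proj_embed_trans:
  assumes "n \<le> m"
  shows "proj_embed m (Suc m) (proj_embed n m p) = proj_embed n (Suc m) p"
  unfolding proj_embed_def image_image
  by (intro image_cong refl ext) (use assms in auto)

text \<open>The ambient dimension is raised by one at a time, and each step adds a sum of natural
  numbers.\<close>

lemma hilbert_fun_embed_mono:
  assumes "n \<le> m" "m \<le> m'"
  shows "hilbert_fun m (fat_ideal m s (\<lambda>j. proj_embed n m (P j)) r) t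
    \<le> hilbert_fun m' (fat_ideal m' s (\<lambda>j. proj_embed n m' (P j)) r) t"
  using assms(2)
proof (induction m' rule: dec_induct)
  case (step m')
  have "hilbert_fun m' (fat_ideal m' s (\<lambda>j. proj_embed n m' (P j)) r) t
      \<le> hilbert_fun (Suc m') (fat_ideal (Suc m') s (\<lambda>j. proj_embed n (Suc m') (P j)) r) t"
    using hilbert_fun_embed'[of m' s "\<lambda>j. proj_embed n m' (P j)" r t] assms(1) step.hyps
    by (simp add: proj_embed_trans)
  with step.IH show ?case by simp
qed simp

text \<open>Some coordinate X_i is nonzero at the point, so its \<open>t\<close>-th power is a form
  of degree \<open>t\<close> outside \<open>I\<close>.\<close>

lemma hilbert_fun_pos:
  assumes "p \<in> proj_space n" "I \<subseteq> point_ideal n p" and I: "ideal I (poly_ring n)"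
  shows "0 < hilbert_fun n I t"
proof -
  obtain a where a: "a \<in> nonzero_vecs n" "p = proportional n `` {a}"
    using assms(1) unfolding proj_space_def by (rule quotientE)
  then obtain i where i: "i \<le> n" "a i \<noteq> 0" by (auto simp: nonzero_vecs_def)
  have "a \<in> p"
    using a by (auto simp: proportional_def intro: exI[of _ 1])
  obtain A and b :: "(nat \<Rightarrow>\<^sub>0 nat) \<Rightarrow> _" where basis: "quot_basis n t I A b"
    using exists_quot_basis[OF I] by blast
  have "A \<noteq> {}"
  proof
    assume "A = {}"
    \<comment> \<open>Over the empty basis every combination is 0, so all forms of degree
      \<open>t\<close> would lie in \<open>I\<close>.\<close>
    with basis have "indet i ^ t \<in> I"
      using indet_power_homog_part[OF i(1), of t]
      by (auto simp: quot_basis_def lin_comb_def)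
    with assms(2) have "eval_pol (indet i ^ t) a = 0"
      using point_ideal_vanishes \<open>a \<in> p\<close> by blast
    with i(2) show False by simp
  qed
  moreover have "finite A" using basis by (simp add: quot_basis_def)
  ultimately show ?thesis
    using hilbert_fun_quot_basis[OF I basis] by (simp add: card_gt_0_iff)
qed

theorem corollary4p6:
  fixes n m s :: nat
    and P :: "nat \<Rightarrow> (nat \<Rightarrow> 'a::alg_closed_field) set"
    and \<mu> :: "nat \<Rightarrow> nat"
  assumes "0 < n" and "n < m"
    and "\<forall>j \<in> {1..s}. P j \<in> proj_space n"
    and "inj_on P {1..s}"
    and "\<forall>j \<in> {1..s}. 0 < \<mu> j"
  shows
    "(m = n + 1 \<longrightarrow> (\<forall>t. t < reg_index n s P \<mu> \<longrightarrow>
        hilbert_fun (n + 1) (fat_ideal (n + 1) s (\<lambda>j. proj_embed n (n + 1) (P j)) (\<lambda>j. int (\<mu> j))) t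
        = hilbert_fun n (fat_ideal n s P (\<lambda>j. int (\<mu> j))) t
          + (\<Sum>i<t. hilbert_fun n (fat_ideal n s P (\<lambda>j. int (\<mu> j) - int t + int i)) i)))
     \<and> (\<forall>t. hilbert_fun m (fat_ideal m s (\<lambda>j. proj_embed n m (P j)) (\<lambda>j. int (\<mu> j))) t
            \<ge> hilbert_fun n (fat_ideal n s P (\<lambda>j. int (\<mu> j))) t)
     \<and> ((\<exists>j \<in> {1..s}. \<mu> j \<ge> 2) \<longrightarrow>
         (\<forall>t \<ge> 1. hilbert_fun m (fat_ideal m s (\<lambda>j. proj_embed n m (P j)) (\<lambda>j. int (\<mu> j))) t
            > hilbert_fun n (fat_ideal n s P (\<lambda>j. int (\<mu> j))) t))"
proof (intro conjI impI allI)
  let ?r = "\<lambda>j. int (\<mu> j)"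
  let ?H = "\<lambda>t. hilbert_fun n (fat_ideal n s P ?r) t"
  let ?H' = "\<lambda>m t. hilbert_fun m (fat_ideal m s (\<lambda>j. proj_embed n m (P j)) ?r) t"
  note step = hilbert_fun_embed'[of n s P ?r]
  show "?H' (n + 1) t = ?H t
      + (\<Sum>i<t. hilbert_fun n (fat_ideal n s P (\<lambda>j. int (\<mu> j) - int t + int i)) i)" for t
    using step by simp
  \<comment> \<open>This reduces both inequalities to the embedding into dimension n+1, where the
    sum formula applies.\<close>
  have mono: "?H' (Suc n) t \<le> ?H' m t" for t
    by (rule hilbert_fun_embed_mono) (use \<open>n < m\<close> in auto)
  show "?H t \<le> ?H' m t" for t
    using mono[of t] step[of t] by simp
  fix t :: nat
  assume "\<exists>j \<in> {1..s}. 2 \<le> \<mu> j" and "1 \<le> t"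
  then obtain j t' where j: "j \<in> {1..s}" "2 \<le> \<mu> j" and t: "t = Suc t'"
    by (metis Suc_le_D One_nat_def)
  \<comment> \<open>The summand used is \<open>i = t' = t - 1\<close>, which exists because
    \<open>t >= 1\<close>; for \<open>t = 0\<close> the sum is empty. It lowers all multiplicities
    by 1, so the one at \<open>P j\<close> is still at least 1.\<close>
  let ?F = "\<lambda>i. fat_ideal n s P (\<lambda>j. int (\<mu> j) - int t + int i)"
  have "?F t' \<subseteq> point_pow n (P j) (nat (int (\<mu> j) - int t + int t'))"
    using j(1) by (auto simp: fat_ideal_iff)
  also have "\<dots> \<subseteq> point_pow n (P j) 1"
    using j(2) t by (intro point_pow_antimono) auto
  finally have "0 < hilbert_fun n (?F t') t'"
    using assms(3) j(1) by (intro hilbert_fun_pos ideal_fat_ideal) (auto simp only: point_pow_1)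
  also have "\<dots> \<le> (\<Sum>i<t. hilbert_fun n (?F i) i)"
    by (rule member_le_sum) (auto simp: t)
  finally show "?H t < ?H' m t"
    using mono[of t] step[of t] by simp
qed

end
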